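(* Let $n\ge1$, $\Theta\subseteq\mathsf{FORM}_n$ and $\psi\in\mathsf{FORM}_n$. Then for every integer $m\ge n$, $\Theta\models_{(n,\partial)}\psi$ if and only if $\Theta\models_{(m,\partial)}\psi$.
   Context: $\mathsf{FORM}_k$ is the set of formulas of infinite-valued Łukasiewicz propositional logic in the variables $X_1,\dots,X_k$; note $\mathsf{FORM}_n\subseteq\mathsf{FORM}_m$ for $n\le m$. Each $\phi\in\mathsf{FORM}_k$ determines a function $\hat\phi\colon[0,1]^k\to[0,1]$: a point $v\in[0,1]^k$ assigns $v_i$ to $X_i$ and $\hat\phi(v)$ is the truth value computed with $\neg x=1-x$, $x\oplus y=\min(1,x+y)$. Differential valuation in $\mathbb R^k$: for $0\le t\le k$, a tuple $U=(u_0,\dots,u_t)$ of vectors in $\mathbb R^k$ with $u_1,\dots,u_t$ pairwise orthogonal unit vectors, such that for all sufficiently large integers $j$ the simplex $T_{U,j}=\mathrm{conv}(u_0,\,u_0+u_1/j,\dots,u_0+u_1/j+\cdots+u_t/j^t)$ is contained in $[0,1]^k$. $U$ satisfies $\psi\in\mathsf{FORM}_k$ if $\hat\psi=1$ on $T_{U,j}$ for some $j$. For $\Theta\subseteq\mathsf{FORM}_k$, $\psi\in\mathsf{FORM}_k$, $\Theta\models_{(k,\partial)}\psi$ means that every differential valuation in $\mathbb R^k$ satisfying every $\theta\in\Theta$ (viewed as elements of $\mathsf{FORM}_k$) also satisfies $\psi$. *)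

theory Defs
  imports "HOL-Analysis.Analysis" "HOL-Analysis.Finite_Function_Topology"
begin

text \<open>
  \<open>Var i\<close> stands for the variable \<open>X\<^sub>i\<close>, with indices starting at 1. The primitive connectives
  are negation and strong disjunction; the other Lukasiewicz connectives abbreviate
  combinations of these two.
\<close>

datatype form = Var nat | Neg form | Oplus form form

primrec vars :: "form \<Rightarrow> nat set" where
  "vars (Var i) = {i}"
| "vars (Neg \<phi>) = vars \<phi>"
| "vars (Oplus \<phi> \<rho>) = vars \<phi> \<union> vars \<rho>"

definition FORM :: "nat \<Rightarrow> form set" where
  "FORM k = {\<phi>. vars \<phi> \<subseteq> {1..k}}"

text \<open>
  A vector of \<open>\<real>\<^sup>k\<close> is a finitely supported function on the indices that vanishes outside
  \<open>{1..k}\<close>. This keeps the dimension a term, and the type is a real vector space, so the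
  library's convex hull applies.
\<close>

type_synonym vect = "nat \<Rightarrow>\<^sub>0 real"

definition Rn :: "nat \<Rightarrow> vect set" where
  "Rn k = {x. Poly_Mapping.keys x \<subseteq> {1..k}}"

definition dot :: "nat \<Rightarrow> vect \<Rightarrow> vect \<Rightarrow> real" where
  "dot k x y = (\<Sum>i = 1..k. Poly_Mapping.lookup x i * Poly_Mapping.lookup y i)"

definition cube :: "nat \<Rightarrow> vect set" where
  "cube k = {x \<in> Rn k. \<forall>i\<in>{1..k}. 0 \<le> Poly_Mapping.lookup x i \<and> Poly_Mapping.lookup x i \<le> 1}"

text \<open>\<open>hat \<phi>\<close> is meaningful as the truth function of \<open>\<phi> \<in> FORM k\<close> only at points of \<open>cube k\<close>.\<close>

primrec hat :: "form \<Rightarrow> vect \<Rightarrow> real" where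
  "hat (Var i) v = Poly_Mapping.lookup v i"
| "hat (Neg \<phi>) v = 1 - hat \<phi> v"
| "hat (Oplus \<phi> \<rho>) v = min 1 (hat \<phi> v + hat \<rho> v)"

text \<open>A tuple \<open>(u\<^sub>0, \<dots>, u\<^sub>t)\<close> is a list of length \<open>t + 1\<close>.\<close>

definition vertex :: "vect list \<Rightarrow> nat \<Rightarrow> nat \<Rightarrow> vect" where
  "vertex U j i = U ! 0 + (\<Sum>l = 1..i. (1 / real j ^ l) *\<^sub>R (U ! l))"

definition simplexT :: "vect list \<Rightarrow> nat \<Rightarrow> vect set" where
  "simplexT U j = convex hull (vertex U j ` {..<length U})"

definition diff_valuation :: "nat \<Rightarrow> vect list \<Rightarrow> bool" where
  "diff_valuation k U \<longleftrightarrow>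
     (\<exists>t\<le>k. length U = Suc t \<and>
        set U \<subseteq> Rn k \<and>
        (\<forall>a\<in>{1..t}. dot k (U ! a) (U ! a) = 1) \<and>
        (\<forall>a\<in>{1..t}. \<forall>b\<in>{1..t}. a \<noteq> b \<longrightarrow> dot k (U ! a) (U ! b) = 0) \<and>
        (\<forall>\<^sub>F j in sequentially. simplexT U j \<subseteq> cube k))"

text \<open>
  The index \<open>j\<close> must be positive, and the simplex must lie in the domain \<open>cube k\<close> of the truth
  function for the equation to make sense on it.
\<close>

definition satisfies :: "nat \<Rightarrow> vect list \<Rightarrow> form \<Rightarrow> bool" where
  "satisfies k U \<psi> \<longleftrightarrow>
     (\<exists>j\<ge>1. simplexT U j \<subseteq> cube k \<and> (\<forall>x\<in>simplexT U j. hat \<psi> x = 1))"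

definition diff_entails :: "nat \<Rightarrow> form set \<Rightarrow> form \<Rightarrow> bool" where
  "diff_entails k \<Theta> \<psi> \<longleftrightarrow>
     (\<forall>U. diff_valuation k U \<longrightarrow> (\<forall>\<theta>\<in>\<Theta>. satisfies k U \<theta>) \<longrightarrow> satisfies k U \<psi>)"

end

theory Submission
  imports Defs
begin

text \<open>
  Satisfaction of a formula by \<open>U\<close> depends only on the germ of \<open>T\<^sub>U\<^sub>,\<^sub>j\<close> as \<open>j \<rightarrow> \<infinity>\<close>, that is,
  on the filter generated by these simplices. The truth function of a formula of \<open>FORM n\<close>
  factors through the coordinate projection of \<open>\<real>\<^sup>m\<close> onto \<open>\<real>\<^sup>n\<close>. The projected directions are
  no longer orthonormal, but Gram-Schmidt, dropping the vectors that vanish on the way,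
  makes them so without changing the germ.
\<close>

section \<open>Simplices spanned by a flag of directions\<close>

primrec corner :: "nat \<Rightarrow> 'a::real_vector list \<Rightarrow> 'a set" where
  "corner j [] = {0}"
| "corner j (w # ws) = (\<lambda>(a, x). a *\<^sub>R (w + x)) ` ({0..1 / real j} \<times> corner j ws)"

lemma corner_antimono:
  assumes "1 \<le> i" "i \<le> j"
  shows "corner j ws \<subseteq> corner i ws"
proof (induction ws)
  case (Cons w ws)
  moreover have "1 / real j \<le> 1 / real i"
    using assms by (simp add: frac_le)
  ultimately show ?case
    by (auto intro!: image_mono Sigma_mono)
qed simp

definition corner_vertex :: "nat \<Rightarrow> 'a::real_vector list \<Rightarrow> nat \<Rightarrow> 'a" where
  "corner_vertex j ws i = (\<Sum>l<i. (1 / real j ^ Suc l) *\<^sub>R (ws ! l))"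

lemma corner_vertex_0 [simp]: "corner_vertex j ws 0 = 0"
  by (simp add: corner_vertex_def)

lemma corner_vertex_Cons_Suc:
  "corner_vertex j (w # ws) (Suc i) = (1 / real j) *\<^sub>R (w + corner_vertex j ws i)"
  unfolding corner_vertex_def
  by (simp add: sum.lessThan_Suc_shift scaleR_add_right scaleR_sum_right del: sum.lessThan_Suc)

lemma convex_hull_corner_vertex:
  assumes "1 \<le> j"
  shows "convex hull (corner_vertex j ws ` {..length ws}) = corner j ws"
proof (induction ws)
  case (Cons w ws)
  let ?V = "corner_vertex j ws ` {..length ws}"
  have "corner_vertex j (w # ws) ` {..length (w # ws)}
      = insert 0 ((*\<^sub>R) (1 / real j) ` (+) w ` ?V)"
    by (simp add: atMost_Suc_eq_insert_0 image_image corner_vertex_Cons_Suc)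
  then have "convex hull (corner_vertex j (w # ws) ` {..length (w # ws)})
      = {u *\<^sub>R y |u y. 0 \<le> u \<and> u \<le> 1 \<and> y \<in> (*\<^sub>R) (1 / real j) ` (+) w ` corner j ws}"
    by (auto simp: convex_hull_insert_alt convex_hull_scaling convex_hull_translation Cons.IH)
  also have "\<dots> = corner j (w # ws)"
  proof (intro set_eqI iffI)
    fix x
    assume "x \<in> {u *\<^sub>R y |u y. 0 \<le> u \<and> u \<le> 1 \<and> y \<in> (*\<^sub>R) (1 / real j) ` (+) w ` corner j ws}"
    then obtain u y where "0 \<le> u" "u \<le> 1" "y \<in> corner j ws" "x = (u / real j) *\<^sub>R (w + y)"
      by auto
    then show "x \<in> corner j (w # ws)"
      by (auto intro!: image_eqI[of _ _ "(u / real j, y)"] divide_right_mono)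
  next
    fix x
    assume "x \<in> corner j (w # ws)"
    then obtain a y where "0 \<le> a" "a \<le> 1 / real j" "y \<in> corner j ws" "x = a *\<^sub>R (w + y)"
      by auto
    moreover have "x = (a * real j) *\<^sub>R (1 / real j) *\<^sub>R (w + y)" "a * real j \<le> 1"
      using calculation assms by (simp_all add: field_simps)
    ultimately show
      "x \<in> {u *\<^sub>R y |u y. 0 \<le> u \<and> u \<le> 1 \<and> y \<in> (*\<^sub>R) (1 / real j) ` (+) w ` corner j ws}"
      by (intro CollectI exI[of _ "a * real j"] exI[of _ "(1 / real j) *\<^sub>R (w + y)"]) auto
  qed
  finally show ?case .
qed simp

lemma simplexT_Cons:
  assumes "1 \<le> j"
  shows "simplexT (u # ws) j = (+) u ` corner j ws"
proof -
  have "vertex (u # ws) j i = u + corner_vertex j ws i" for i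
    by (simp add: vertex_def corner_vertex_def sum.atLeast1_atMost_eq)
  then have "vertex (u # ws) j ` {..<length (u # ws)}
      = (+) u ` corner_vertex j ws ` {..length ws}"
    by (simp add: image_image lessThan_Suc_atMost)
  then show ?thesis
    by (simp only: simplexT_def convex_hull_translation convex_hull_corner_vertex[OF assms])
qed

section \<open>Germs of flags of directions\<close>

text \<open>Unlike \<open>at_right 0\<close>, the filter \<open>nhds_nonneg 0\<close> sees \<open>0\<close>, as the simplices are closed.\<close>

definition nhds_nonneg :: "real \<Rightarrow> real filter" where
  "nhds_nonneg c = inf (nhds c) (principal {0..})"

lemma filterlim_nhds_nonneg:
  "filterlim f (nhds_nonneg c) F \<longleftrightarrow> (f \<longlongrightarrow> c) F \<and> (\<forall>\<^sub>F z in F. 0 \<le> f z)"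
  by (simp add: nhds_nonneg_def filterlim_inf filterlim_principal)

lemma eventually_nhds_nonneg_0:
  "(\<forall>\<^sub>F a in nhds_nonneg 0. P a) \<longleftrightarrow> (\<exists>j\<ge>1. \<forall>a\<in>{0..1 / real j}. P a)"
proof
  assume "\<forall>\<^sub>F a in nhds_nonneg 0. P a"
  then obtain d where d: "0 < d" "\<And>a. 0 \<le> a \<Longrightarrow> a < d \<Longrightarrow> P a"
    by (auto simp: nhds_nonneg_def eventually_inf_principal eventually_nhds_metric)
  then obtain i where i: "inverse (real (Suc i)) < d"
    using reals_Archimedean by blast
  have "P a" if "a \<in> {0..1 / real (Suc i)}" for a
    using that i by (intro d(2)) (auto simp: inverse_eq_divide)
  then show "\<exists>j\<ge>1. \<forall>a\<in>{0..1 / real j}. P a"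
    by (intro exI[of _ "Suc i"]) auto
next
  assume "\<exists>j\<ge>1. \<forall>a\<in>{0..1 / real j}. P a"
  then obtain j where "1 \<le> j" "\<And>a. 0 \<le> a \<Longrightarrow> a \<le> 1 / real j \<Longrightarrow> P a"
    by auto
  then show "\<forall>\<^sub>F a in nhds_nonneg 0. P a"
    unfolding nhds_nonneg_def eventually_inf_principal eventually_nhds_metric
    by (intro exI[of _ "1 / real j"]) auto
qed

primrec corner_germ :: "'a::real_vector list \<Rightarrow> 'a filter" where
  "corner_germ [] = principal {0}"
| "corner_germ (w # ws) =
     filtermap (\<lambda>(a, x). a *\<^sub>R (w + x)) (nhds_nonneg 0 \<times>\<^sub>F corner_germ ws)"

lemma eventually_corner_germ:
  "(\<forall>\<^sub>F x in corner_germ ws. P x) \<longleftrightarrow> (\<exists>j\<ge>1. \<forall>x\<in>corner j ws. P x)"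
proof (induction ws arbitrary: P)
  case Nil
  then show ?case by (auto simp: eventually_principal)
next
  case (Cons w ws)
  show ?case
  proof
    assume "\<forall>\<^sub>F x in corner_germ (w # ws). P x"
    then obtain Q R where "\<forall>\<^sub>F a in nhds_nonneg 0. Q a" "\<forall>\<^sub>F x in corner_germ ws. R x"
      and QR: "\<And>a x. Q a \<Longrightarrow> R x \<Longrightarrow> P (a *\<^sub>R (w + x))"
      by (auto simp: eventually_filtermap eventually_prod_filter)
    then obtain i j where i: "1 \<le> i" "\<And>a. a \<in> {0..1 / real i} \<Longrightarrow> Q a"
      and j: "1 \<le> j" "\<And>x. x \<in> corner j ws \<Longrightarrow> R x"
      unfolding eventually_nhds_nonneg_0 Cons.IH by blast
    let ?k = "max i j"
    have "1 / real ?k \<le> 1 / real i"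
      using i(1) by (simp add: frac_le)
    moreover have "corner ?k ws \<subseteq> corner j ws"
      using j(1) by (intro corner_antimono) auto
    ultimately have "\<forall>x\<in>corner ?k (w # ws). P x"
      using i(2) j(2) by (auto intro!: QR)
    with i(1) show "\<exists>k\<ge>1. \<forall>x\<in>corner k (w # ws). P x"
      by (intro exI[of _ ?k]) auto
  next
    assume "\<exists>j\<ge>1. \<forall>x\<in>corner j (w # ws). P x"
    then obtain j where "1 \<le> j" and P: "\<forall>x\<in>corner j (w # ws). P x" by blast
    then have "\<forall>\<^sub>F a in nhds_nonneg 0. a \<in> {0..1 / real j}"
      "\<forall>\<^sub>F x in corner_germ ws. x \<in> corner j ws"
      unfolding eventually_nhds_nonneg_0 Cons.IH by blast+
    then have "\<forall>\<^sub>F (a, x) in nhds_nonneg 0 \<times>\<^sub>F corner_germ ws.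
        a \<in> {0..1 / real j} \<and> x \<in> corner j ws"
      by (auto simp: eventually_prod_filter)
    then show "\<forall>\<^sub>F x in corner_germ (w # ws). P x"
      using P by (auto simp: eventually_filtermap elim!: eventually_mono)
  qed
qed

lemma filtermap_linear_corner_germ:
  assumes "linear f"
  shows "filtermap f (corner_germ ws) = corner_germ (map f ws)"
proof (induction ws)
  case Nil
  then show ?case by (simp add: linear_0[OF assms])
next
  case (Cons w ws)
  have "f (a *\<^sub>R (w + x)) = a *\<^sub>R (f w + f x)" for a x
    by (simp add: linear_add[OF assms] linear_scale[OF assms])
  then show ?case
    by (simp add: Cons.IH[symmetric] filtermap_filtermap prod_filtermap2 case_prod_beta)
qed

lemma tendsto_linear_corner_germ:
  fixes f :: "'a::real_vector \<Rightarrow> 'b::real_normed_vector"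
  assumes "linear f"
  shows "(f \<longlongrightarrow> 0) (corner_germ ws)"
proof (induction ws)
  case Nil
  show ?case using tendsto_principal_singleton[of f 0] by (simp add: linear_0[OF assms])
next
  case (Cons w ws)
  let ?F = "nhds_nonneg 0 \<times>\<^sub>F corner_germ ws"
  have "filterlim fst (nhds_nonneg 0) ?F" by (rule filterlim_fst)
  then have "(fst \<longlongrightarrow> 0) ?F" by (simp add: filterlim_nhds_nonneg)
  moreover have "((\<lambda>z. f (snd z)) \<longlongrightarrow> 0) ?F"
    using Cons.IH filterlim_snd by (rule filterlim_compose)
  ultimately have "((\<lambda>z. fst z *\<^sub>R (f w + f (snd z))) \<longlongrightarrow> 0) ?F"
    by (auto intro!: tendsto_eq_intros)
  then show ?case
    by (simp add: filterlim_filtermap case_prod_beta linear_add[OF assms] linear_scale[OF assms])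
qed

lemma filterlim_corner_germ_Cons:
  assumes "filterlim a (nhds_nonneg 0) F" "filterlim x (corner_germ ws) F"
  shows "filterlim (\<lambda>z. a z *\<^sub>R (w + x z)) (corner_germ (w # ws)) F"
proof -
  have "filterlim (\<lambda>(a, x). a *\<^sub>R (w + x)) (corner_germ (w # ws))
      (nhds_nonneg 0 \<times>\<^sub>F corner_germ ws)"
    by (simp add: filterlim_def)
  from filterlim_compose[OF this filterlim_Pair[OF assms]] show ?thesis by simp
qed

lemma corner_germ_Cons_le_iff:
  "corner_germ (w # ws) \<le> G \<longleftrightarrow>
     filterlim (\<lambda>z. fst z *\<^sub>R (w + snd z)) G (nhds_nonneg 0 \<times>\<^sub>F corner_germ ws)"
  by (simp add: filterlim_def case_prod_beta')

lemma filterlim_nhds_nonneg_mult: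
  assumes "filterlim f (nhds_nonneg b) F" "filterlim g (nhds_nonneg c) F"
  shows "filterlim (\<lambda>z. f z * g z) (nhds_nonneg (b * c)) F"
  using assms by (auto simp: filterlim_nhds_nonneg intro: tendsto_mult elim: eventually_elim2)

lemma filterlim_scaleR_corner_germ:
  assumes lim_r: "filterlim r (nhds_nonneg c) F" and lim_x: "filterlim x (corner_germ ws) F"
  shows "filterlim (\<lambda>z. r z *\<^sub>R x z) (corner_germ ws) F"
proof -
  let ?F = "nhds_nonneg c \<times>\<^sub>F corner_germ ws"
  have "filterlim (\<lambda>(r, x). r *\<^sub>R x) (corner_germ ws) ?F"
  proof (cases ws)
    case Nil
    have "\<forall>\<^sub>F z in ?F. snd z = 0"
      using filterlim_snd[of "corner_germ ws" "nhds_nonneg c"] by (simp add: Nil filterlim_principal)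
    then show ?thesis
      by (auto simp: Nil filterlim_principal elim: eventually_mono)
  next
    case (Cons w ws')
    let ?G = "nhds_nonneg c \<times>\<^sub>F (nhds_nonneg 0 \<times>\<^sub>F corner_germ ws')"
    have lim_a: "filterlim (\<lambda>z. fst (snd z)) (nhds_nonneg 0) ?G"
      and lim_y: "filterlim (\<lambda>z. snd (snd z)) (corner_germ ws') ?G"
      by (rule filterlim_compose[OF filterlim_fst filterlim_snd]
          filterlim_compose[OF filterlim_snd filterlim_snd])+
    have "filterlim (\<lambda>z. fst z * fst (snd z)) (nhds_nonneg 0) ?G"
      using filterlim_nhds_nonneg_mult[OF filterlim_fst lim_a] by simp
    from filterlim_corner_germ_Cons[OF this lim_y, of w] show ?thesis
      by (simp add: Cons prod_filtermap2 filterlim_filtermap case_prod_beta)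
  qed
  from filterlim_compose[OF this filterlim_Pair[OF lim_r lim_x]] show ?thesis by simp
qed

lemma corner_germ_zero_Cons: "corner_germ (0 # ws) = corner_germ ws"
proof (rule antisym)
  show "corner_germ (0 # ws) \<le> corner_germ ws"
    using filterlim_scaleR_corner_germ[OF filterlim_fst filterlim_snd]
    by (simp add: corner_germ_Cons_le_iff del: corner_germ.simps)
  show "corner_germ ws \<le> corner_germ (0 # ws)"
  proof (rule filter_leI)
    fix P :: "'a \<Rightarrow> bool"
    assume "eventually P (corner_germ (0 # ws))"
    then obtain Q R where "\<forall>\<^sub>F a in nhds_nonneg 0. Q a" and R: "\<forall>\<^sub>F x in corner_germ ws. R x"
      and QR: "\<And>a x. Q a \<Longrightarrow> R x \<Longrightarrow> P (a *\<^sub>R x)"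
      by (auto simp: eventually_filtermap eventually_prod_filter)
    then obtain j where j: "1 \<le> j" and Q: "Q (1 / real j)"
      unfolding eventually_nhds_nonneg_0 by fastforce
    have "filterlim (\<lambda>x. real j *\<^sub>R x) (corner_germ ws) (corner_germ ws)"
      by (rule filterlim_scaleR_corner_germ[of _ "real j"])
        (auto simp: filterlim_nhds_nonneg filterlim_ident)
    with R have "\<forall>\<^sub>F x in corner_germ ws. R (real j *\<^sub>R x)"
      by (rule eventually_compose_filterlim)
    moreover have "P x" if "R (real j *\<^sub>R x)" for x
      using QR[OF Q that] j by simp
    ultimately show "eventually P (corner_germ ws)"
      by (rule eventually_mono)
  qed
qed

lemma filterlim_corner_germ_Cons_rescaled:
  assumes lim_a: "filterlim a (nhds_nonneg 0) F" and lim_r: "(r \<longlongrightarrow> c) F" "0 < c"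
    and lim_x: "filterlim x (corner_germ ws) F"
  shows "filterlim (\<lambda>z. a z *\<^sub>R (r z *\<^sub>R w + x z)) (corner_germ (w # ws)) F"
proof -
  have r_pos: "\<forall>\<^sub>F z in F. 0 < r z"
    using lim_r by (rule order_tendstoD)
  then have "filterlim r (nhds_nonneg c) F" "filterlim (\<lambda>z. 1 / r z) (nhds_nonneg (1 / c)) F"
    using lim_r tendsto_divide[OF tendsto_const lim_r(1), of 1]
    by (auto simp: filterlim_nhds_nonneg elim: eventually_mono)
  then have "filterlim (\<lambda>z. a z * r z) (nhds_nonneg 0) F"
    and "filterlim (\<lambda>z. (1 / r z) *\<^sub>R x z) (corner_germ ws) F"
    using filterlim_nhds_nonneg_mult[OF lim_a] filterlim_scaleR_corner_germ[OF _ lim_x]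
    by fastforce+
  then have "filterlim (\<lambda>z. (a z * r z) *\<^sub>R (w + (1 / r z) *\<^sub>R x z)) (corner_germ (w # ws)) F"
    by (rule filterlim_corner_germ_Cons)
  moreover have "\<forall>\<^sub>F z in F. (a z * r z) *\<^sub>R (w + (1 / r z) *\<^sub>R x z) = a z *\<^sub>R (r z *\<^sub>R w + x z)"
    using r_pos by eventually_elim (simp add: scaleR_add_right)
  ultimately show ?thesis
    by (simp only: filterlim_cong)
qed

lemma corner_germ_scaleR_Cons:
  assumes "0 < r"
  shows "corner_germ (r *\<^sub>R w # ws) = corner_germ (w # ws)"
proof -
  have scaleR_le: "corner_germ (s *\<^sub>R v # ws) \<le> corner_germ (v # ws)" if "0 < s" for s and v :: 'a
    unfolding corner_germ_Cons_le_iff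
    using filterlim_corner_germ_Cons_rescaled[OF filterlim_fst tendsto_const that filterlim_snd] .
  show ?thesis
    using scaleR_le[of r w] scaleR_le[of "1 / r" "r *\<^sub>R w"] assms by (auto intro: antisym)
qed

lemma linear_shear:
  fixes f :: "'a::real_vector \<Rightarrow> real"
  assumes "linear f" "linear g"
  shows "linear (\<lambda>x. g x + f x *\<^sub>R w)"
  by (intro linear_compose_add assms linear_compose[OF assms(1) linear_scaleR_left, unfolded o_def])

lemma corner_germ_shear_le:
  fixes f :: "'a::real_vector \<Rightarrow> real"
  assumes f: "linear f" and g: "linear g"
  shows "corner_germ (w # map (\<lambda>x. g x + f x *\<^sub>R w) ws) \<le> corner_germ (w # map g ws)"
proof -
  let ?F = "nhds_nonneg 0 \<times>\<^sub>F corner_germ ws"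
  have "((\<lambda>z. f (snd z)) \<longlongrightarrow> 0) ?F"
    using tendsto_linear_corner_germ[OF f] filterlim_snd by (rule filterlim_compose)
  then have "((\<lambda>z. 1 + f (snd z)) \<longlongrightarrow> 1) ?F"
    by (auto intro!: tendsto_eq_intros)
  moreover have "filterlim g (corner_germ (map g ws)) (corner_germ ws)"
    by (simp add: filterlim_def filtermap_linear_corner_germ[OF g])
  then have "filterlim (\<lambda>z. g (snd z)) (corner_germ (map g ws)) ?F"
    using filterlim_snd by (rule filterlim_compose)
  ultimately have "filterlim (\<lambda>z. fst z *\<^sub>R ((1 + f (snd z)) *\<^sub>R w + g (snd z)))
      (corner_germ (w # map g ws)) ?F"
    by (intro filterlim_corner_germ_Cons_rescaled[OF filterlim_fst]) auto
  then show ?thesis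
    by (simp add: filtermap_linear_corner_germ[OF linear_shear[OF f g], symmetric]
        corner_germ_Cons_le_iff prod_filtermap2 filterlim_filtermap scaleR_add_left ac_simps
        del: corner_germ.simps)
qed

lemma corner_germ_shear:
  fixes f :: "'a::real_vector \<Rightarrow> real"
  assumes f: "linear f" and g: "linear g"
  shows "corner_germ (w # map (\<lambda>x. g x + f x *\<^sub>R w) ws) = corner_germ (w # map g ws)"
proof (rule antisym[OF corner_germ_shear_le[OF f g]])
  from corner_germ_shear_le[OF linear_compose_neg[OF f] linear_shear[OF f g], of w w ws]
  show "corner_germ (w # map g ws) \<le> corner_germ (w # map (\<lambda>x. g x + f x *\<^sub>R w) ws)"
    by simp
qed

section \<open>Gram-Schmidt orthonormalization\<close>

locale inner_product_on =
  fixes S :: "'a::real_vector set" and ip :: "'a \<Rightarrow> 'a \<Rightarrow> real"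
  assumes subspace: "subspace S"
    and linear_left: "linear (\<lambda>x. ip x y)"
    and commute: "ip x y = ip y x"
    and pos: "x \<in> S \<Longrightarrow> x \<noteq> 0 \<Longrightarrow> 0 < ip x x"
begin

lemmas add_left = linear_add[OF linear_left]
  and diff_left = linear_diff[OF linear_left]
  and scaleR_left = linear_scale[OF linear_left]
  and zero_left = linear_0[OF linear_left]

lemma scaleR_right: "ip x (r *\<^sub>R y) = r * ip x y"
  using scaleR_left[of r y x] by (simp add: commute)

definition orthonormal :: "'a list \<Rightarrow> bool" where
  "orthonormal vs \<longleftrightarrow> (\<forall>v\<in>set vs. ip v v = 1) \<and> sorted_wrt (\<lambda>v w. ip v w = 0) vs"

lemma orthonormal_Nil [simp]: "orthonormal []"
  by (simp add: orthonormal_def)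

lemma orthonormal_Cons:
  "orthonormal (v # vs) \<longleftrightarrow> ip v v = 1 \<and> (\<forall>w\<in>set vs. ip v w = 0) \<and> orthonormal vs"
  by (auto simp: orthonormal_def)

lemma orthonormal_iff_nth:
  "orthonormal vs \<longleftrightarrow>
     (\<forall>a<length vs. ip (vs ! a) (vs ! a) = 1) \<and>
     (\<forall>a<length vs. \<forall>b<length vs. a \<noteq> b \<longrightarrow> ip (vs ! a) (vs ! b) = 0)"
proof -
  have "sorted_wrt (\<lambda>v w. ip v w = 0) vs \<longleftrightarrow>
      (\<forall>a<length vs. \<forall>b<length vs. a \<noteq> b \<longrightarrow> ip (vs ! a) (vs ! b) = 0)"
    (is "?sorted \<longleftrightarrow> ?pairwise")
  proof
    assume ?sorted
    show ?pairwise
    proof (intro allI impI)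
      fix a b
      assume "a < length vs" "b < length vs" "a \<noteq> b"
      then show "ip (vs ! a) (vs ! b) = 0"
        using sorted_wrt_nth_less[OF \<open>?sorted\<close>, of a b]
          sorted_wrt_nth_less[OF \<open>?sorted\<close>, of b a]
        by (cases "a < b") (auto simp: commute)
    qed
  qed (simp add: sorted_wrt_iff_nth_less)
  then show ?thesis
    by (simp add: orthonormal_def all_set_conv_all_nth)
qed

lemma orthonormal_imp_distinct_independent:
  assumes "orthonormal vs"
  shows "distinct vs \<and> independent (set vs)"
  using assms
proof (induction vs)
  case (Cons v vs)
  then have IH: "distinct vs" "independent (set vs)" and "ip v v = 1"
    and orth: "\<And>x. x \<in> set vs \<Longrightarrow> ip x v = 0"
    by (auto simp: orthonormal_Cons commute)
  moreover have "ip x v = 0" if "x \<in> span (set vs)" for x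
    using that by (induction rule: span_induct_alt) (auto simp: zero_left add_left scaleR_left orth)
  ultimately have "v \<notin> span (set vs)" by fastforce
  then show ?case
    using IH span_base by (auto simp: independent_insert)
qed (simp add: independent_empty)

definition normalized :: "'a \<Rightarrow> 'a" where
  "normalized w = (1 / sqrt (ip w w)) *\<^sub>R w"

lemma ip_normalized:
  assumes "w \<in> S" "w \<noteq> 0"
  shows "ip (normalized w) (normalized w) = 1"
  using pos[OF assms] by (simp add: normalized_def scaleR_left scaleR_right)

lemma normalized_in_S: "w \<in> S \<Longrightarrow> normalized w \<in> S"
  by (simp add: normalized_def subspace_scale[OF subspace])

definition rejection :: "'a \<Rightarrow> 'a \<Rightarrow> 'a" where
  "rejection e x = x - ip x e *\<^sub>R e"

lemma rejection_in_S: "e \<in> S \<Longrightarrow> x \<in> S \<Longrightarrow> rejection e x \<in> S"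
  by (simp add: rejection_def subspace_diff[OF subspace] subspace_scale[OF subspace])

lemma ip_rejection_self: "ip e e = 1 \<Longrightarrow> ip (rejection e x) e = 0"
  by (simp add: rejection_def diff_left scaleR_left)

lemma ip_rejection_eq_0: "ip e z = 0 \<Longrightarrow> ip x z = 0 \<Longrightarrow> ip (rejection e x) z = 0"
  by (simp add: rejection_def diff_left scaleR_left)

fun gram_schmidt :: "'a list \<Rightarrow> 'a list" where
  "gram_schmidt [] = []"
| "gram_schmidt (w # ws) =
     (if w = 0 then gram_schmidt ws
      else normalized w # gram_schmidt (map (rejection (normalized w)) ws))"

lemma gram_schmidt_induct [case_names Nil zero nonzero]:
  assumes "P []"
    and "\<And>ws. P ws \<Longrightarrow> P (0 # ws)"
    and "\<And>w ws. w \<noteq> 0 \<Longrightarrow> P (map (rejection (normalized w)) ws) \<Longrightarrow> P (w # ws)"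
  shows "P ws"
proof (induction ws rule: gram_schmidt.induct)
  case 1
  show ?case by (rule assms(1))
next
  case (2 w ws)
  then show ?case
    using assms(2)[of ws] assms(3)[of w ws] by (cases "w = 0") simp_all
qed

lemma gram_schmidt_in_S: "set ws \<subseteq> S \<Longrightarrow> set (gram_schmidt ws) \<subseteq> S"
proof (induction ws rule: gram_schmidt_induct)
  case (nonzero w ws)
  then have "set (gram_schmidt (map (rejection (normalized w)) ws)) \<subseteq> S"
    by (intro nonzero.IH) (auto simp: normalized_in_S rejection_in_S)
  with nonzero show ?case by (simp add: normalized_in_S)
qed simp_all

lemma ip_gram_schmidt_eq_0:
  assumes "\<forall>w\<in>set ws. ip w z = 0"
  shows "\<forall>v\<in>set (gram_schmidt ws). ip v z = 0"
  using assms
proof (induction ws rule: gram_schmidt_induct)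
  case (nonzero w ws)
  then have head: "ip (normalized w) z = 0"
    by (simp add: normalized_def scaleR_left)
  with nonzero have "\<forall>v\<in>set (gram_schmidt (map (rejection (normalized w)) ws)). ip v z = 0"
    by (intro nonzero.IH) (auto intro: ip_rejection_eq_0)
  with head nonzero.hyps show ?case by simp
qed simp_all

lemma orthonormal_gram_schmidt: "set ws \<subseteq> S \<Longrightarrow> orthonormal (gram_schmidt ws)"
proof (induction ws rule: gram_schmidt_induct)
  case (nonzero w ws)
  let ?e = "normalized w" and ?ws = "map (rejection (normalized w)) ws"
  have e: "?e \<in> S" "ip ?e ?e = 1"
    using nonzero by (auto simp: normalized_in_S ip_normalized)
  then have "orthonormal (gram_schmidt ?ws)"
    using nonzero by (intro nonzero.IH) (auto simp: rejection_in_S)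
  moreover have "\<forall>v\<in>set (gram_schmidt ?ws). ip v ?e = 0"
    using e by (intro ip_gram_schmidt_eq_0) (simp add: ip_rejection_self)
  ultimately show ?case
    using nonzero e by (simp add: orthonormal_Cons commute)
qed simp_all

lemma corner_germ_gram_schmidt:
  assumes "set ws \<subseteq> S"
  shows "corner_germ (gram_schmidt ws) = corner_germ ws"
  using assms
proof (induction ws rule: gram_schmidt_induct)
  case (zero ws)
  then show ?case using corner_germ_zero_Cons[of ws] by simp
next
  case (nonzero w ws)
  let ?e = "normalized w" and ?ws = "map (rejection (normalized w)) ws"
  have "set ?ws \<subseteq> S"
    using nonzero by (auto simp: normalized_in_S rejection_in_S)
  then have "corner_germ (gram_schmidt (w # ws)) = corner_germ (?e # ?ws)"
    using nonzero by simp
  also have "\<dots> = corner_germ (?e # ws)"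
    using corner_germ_shear[OF linear_compose_neg[OF linear_left] linear_id, of ?e ?e ws]
    by (simp add: rejection_def[abs_def])
  also have "\<dots> = corner_germ (w # ws)"
    unfolding normalized_def using pos[of w] nonzero by (intro corner_germ_scaleR_Cons) auto
  finally show ?case .
qed simp

end

section \<open>Coordinate spaces\<close>

lemma lookup_scaleR:
  "Poly_Mapping.lookup (r *\<^sub>R (x :: 'i \<Rightarrow>\<^sub>0 'a::real_vector)) i = r *\<^sub>R Poly_Mapping.lookup x i"
proof -
  have "finite {i. r *\<^sub>R Poly_Mapping.lookup x i \<noteq> 0}"
    by (rule finite_subset[OF _ finite_lookup[of x]]) auto
  then show ?thesis by (simp add: scaleR_poly_mapping_def)
qed

lemma in_Rn_iff: "x \<in> Rn k \<longleftrightarrow> (\<forall>i. i \<notin> {1..k} \<longrightarrow> Poly_Mapping.lookup x i = 0)"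
  by (auto simp: Rn_def in_keys_iff)

lemma Rn_mono: "n \<le> m \<Longrightarrow> Rn n \<subseteq> Rn m"
  by (auto simp: in_Rn_iff)

lemma cube_mono: "n \<le> m \<Longrightarrow> cube n \<subseteq> cube m"
  by (force simp: cube_def in_Rn_iff)

interpretation dot: inner_product_on "Rn k" "dot k" for k
proof (rule inner_product_on.intro)
  show "subspace (Rn k)"
    by (simp add: subspace_def in_Rn_iff lookup_add lookup_scaleR)
  show "linear (\<lambda>x. dot k x y)" for y
    by (rule linearI)
      (simp_all add: dot_def lookup_add lookup_scaleR sum.distrib sum_distrib_left algebra_simps)
  show "dot k x y = dot k y x" for x y
    by (simp add: dot_def mult.commute)
  fix x
  assume x: "x \<in> Rn k" "x \<noteq> 0"
  show "0 < dot k x x"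
  proof -
    obtain i where i: "Poly_Mapping.lookup x i \<noteq> 0"
      using x(2) by (metis poly_mapping_eqI lookup_zero)
    with x(1) have "i \<in> {1..k}" by (auto simp: in_Rn_iff)
    with i show ?thesis
      unfolding dot_def by (intro sum_pos2[of _ i]) (auto simp: zero_less_mult_iff)
  qed
qed

lemma dot_eq_of_Rn:
  assumes "n \<le> m" "x \<in> Rn n"
  shows "dot m x y = dot n x y"
  unfolding dot_def using assms by (intro sum.mono_neutral_right) (auto simp: in_Rn_iff)

lemma orthonormal_dot_mono:
  assumes "n \<le> m" "set vs \<subseteq> Rn n" "dot.orthonormal n vs"
  shows "dot.orthonormal m vs"
  using assms(2,3)
  by (induction vs) (auto simp: dot.orthonormal_Cons dot_eq_of_Rn[OF assms(1)])

definition proj :: "nat \<Rightarrow> vect \<Rightarrow> vect" where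
  "proj n x = (\<Sum>i = 1..n. Poly_Mapping.lookup x i *\<^sub>R Poly_Mapping.single i 1)"

lemma lookup_proj:
  "Poly_Mapping.lookup (proj n x) i = (if i \<in> {1..n} then Poly_Mapping.lookup x i else 0)"
  by (simp add: proj_def lookup_sum lookup_scaleR lookup_single when_def if_distrib cong: if_cong)

lemma linear_proj: "linear (proj n)"
  by (rule linearI) (auto intro!: poly_mapping_eqI simp: lookup_proj lookup_add lookup_scaleR)

lemma proj_in_Rn: "proj n x \<in> Rn n"
  by (simp add: in_Rn_iff lookup_proj)

lemma proj_eq_self: "x \<in> Rn n \<Longrightarrow> proj n x = x"
  by (rule poly_mapping_eqI) (auto simp: in_Rn_iff lookup_proj)

lemma proj_in_cube: "x \<in> cube m \<Longrightarrow> n \<le> m \<Longrightarrow> proj n x \<in> cube n"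
  by (simp add: cube_def proj_in_Rn lookup_proj)

lemma hat_proj: "\<phi> \<in> FORM n \<Longrightarrow> hat \<phi> (proj n x) = hat \<phi> x"
  by (induction \<phi>) (auto simp: FORM_def lookup_proj)

lemma orthonormal_length_le:
  assumes "dot.orthonormal k vs" "set vs \<subseteq> Rn k"
  shows "length vs \<le> k"
proof -
  let ?B = "(\<lambda>i. Poly_Mapping.single i 1 :: vect) ` {1..k}"
  have vs: "distinct vs" "independent (set vs)"
    using dot.orthonormal_imp_distinct_independent[OF assms(1)] by auto
  have "proj k x \<in> span ?B" for x
    unfolding proj_def by (intro span_sum span_scale span_base) auto
  then have "set vs \<subseteq> span ?B"
    using assms(2) by (metis proj_eq_self subset_iff)
  then have "card (set vs) \<le> card ?B"
    using independent_span_bound[OF _ vs(2)] by blast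
  also have "\<dots> \<le> k" using card_image_le[of "{1..k}"] by fastforce
  finally show ?thesis using vs(1) by (simp add: distinct_card)
qed

section \<open>Differential valuations and their germs\<close>

definition simplex_germ :: "vect list \<Rightarrow> vect filter" where
  "simplex_germ U = filtermap ((+) (hd U)) (corner_germ (tl U))"

lemma eventually_simplex_germ:
  assumes "U \<noteq> []"
  shows "(\<forall>\<^sub>F x in simplex_germ U. P x) \<longleftrightarrow> (\<exists>j\<ge>1. \<forall>x\<in>simplexT U j. P x)"
proof -
  obtain u ws where "U = u # ws"
    using assms by (cases U) auto
  then have "(\<forall>x\<in>corner j ws. P (u + x)) \<longleftrightarrow> (\<forall>x\<in>simplexT U j. P x)" if "1 \<le> j" for j
    using that by (simp add: simplexT_Cons)
  with \<open>U = u # ws\<close> show ?thesis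
    by (auto simp: simplex_germ_def eventually_filtermap eventually_corner_germ)
qed

lemma satisfies_iff_eventually:
  assumes "U \<noteq> []"
  shows "satisfies k U \<psi> \<longleftrightarrow> (\<forall>\<^sub>F x in simplex_germ U. x \<in> cube k \<and> hat \<psi> x = 1)"
  unfolding satisfies_def eventually_simplex_germ[OF assms] by blast

lemma eventually_simplexT_subset_iff:
  assumes "U \<noteq> []"
  shows "(\<forall>\<^sub>F j in sequentially. simplexT U j \<subseteq> A) \<longleftrightarrow> (\<forall>\<^sub>F x in simplex_germ U. x \<in> A)"
proof
  assume "\<forall>\<^sub>F j in sequentially. simplexT U j \<subseteq> A"
  then obtain N where "\<And>j. N \<le> j \<Longrightarrow> simplexT U j \<subseteq> A"
    by (auto simp: eventually_sequentially)
  then have "simplexT U (max 1 N) \<subseteq> A" by simp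
  then show "\<forall>\<^sub>F x in simplex_germ U. x \<in> A"
    unfolding eventually_simplex_germ[OF assms] by (intro exI[of _ "max 1 N"]) auto
next
  obtain u ws where U: "U = u # ws"
    using assms by (cases U) auto
  assume "\<forall>\<^sub>F x in simplex_germ U. x \<in> A"
  then obtain i where "1 \<le> i" "simplexT U i \<subseteq> A"
    unfolding eventually_simplex_germ[OF assms] by blast
  moreover have "simplexT U j \<subseteq> simplexT U i" if "i \<le> j" for j
    using corner_antimono[OF \<open>1 \<le> i\<close> that] \<open>1 \<le> i\<close> that by (auto simp: U simplexT_Cons)
  ultimately show "\<forall>\<^sub>F j in sequentially. simplexT U j \<subseteq> A"
    unfolding eventually_sequentially by blast
qed

lemma diff_valuation_not_Nil: "diff_valuation k U \<Longrightarrow> U \<noteq> []"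
  by (auto simp: diff_valuation_def)

lemma diff_valuation_Cons:
  "diff_valuation k (u # vs) \<longleftrightarrow> u \<in> Rn k \<and> set vs \<subseteq> Rn k \<and> dot.orthonormal k vs \<and>
     (\<forall>\<^sub>F x in simplex_germ (u # vs). x \<in> cube k)"
proof -
  have "dot.orthonormal k vs \<longleftrightarrow>
      (\<forall>a\<in>{1..length vs}. dot k ((u # vs) ! a) ((u # vs) ! a) = 1) \<and>
      (\<forall>a\<in>{1..length vs}. \<forall>b\<in>{1..length vs}. a \<noteq> b \<longrightarrow> dot k ((u # vs) ! a) ((u # vs) ! b) = 0)"
    unfolding dot.orthonormal_iff_nth image_Suc_lessThan[symmetric] by auto
  then show ?thesis
    using orthonormal_length_le[of k vs]
    by (auto simp: diff_valuation_def eventually_simplexT_subset_iff)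
qed

lemma satisfies_diff_valuation_iff:
  assumes "diff_valuation k U"
  shows "satisfies k U \<psi> \<longleftrightarrow> (\<forall>\<^sub>F x in simplex_germ U. hat \<psi> x = 1)"
proof -
  obtain u vs where "U = u # vs"
    using diff_valuation_not_Nil[OF assms] by (cases U) auto
  then show ?thesis
    using assms by (simp add: satisfies_iff_eventually diff_valuation_Cons eventually_conj_iff)
qed

lemma diff_valuation_mono:
  assumes "n \<le> m" "diff_valuation n U"
  shows "diff_valuation m U"
proof -
  obtain u vs where "U = u # vs"
    using diff_valuation_not_Nil[OF assms(2)] by (cases U) auto
  then show ?thesis
    using assms(2) Rn_mono[OF assms(1)] cube_mono[OF assms(1)] orthonormal_dot_mono[OF assms(1)]
    by (auto simp: diff_valuation_Cons elim!: eventually_mono)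
qed

lemma ex_diff_valuation_proj:
  assumes "n \<le> m" "diff_valuation m U"
  obtains V where "diff_valuation n V" "simplex_germ V = filtermap (proj n) (simplex_germ U)"
proof -
  obtain u ws where U: "U = u # ws"
    using diff_valuation_not_Nil[OF assms(2)] by (cases U) auto
  define vs where "vs = dot.gram_schmidt n (map (proj n) ws)"
  have proj_ws: "set (map (proj n) ws) \<subseteq> Rn n"
    by (auto simp: proj_in_Rn)
  have germ: "simplex_germ (proj n u # vs) = filtermap (proj n) (simplex_germ U)"
    using dot.corner_germ_gram_schmidt[OF proj_ws]
    by (simp add: simplex_germ_def U vs_def filtermap_linear_corner_germ[OF linear_proj, symmetric]
        filtermap_filtermap linear_add[OF linear_proj])
  have "\<forall>\<^sub>F x in simplex_germ (proj n u # vs). x \<in> cube n"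
    using assms proj_in_cube[OF _ assms(1)]
    by (auto simp: germ U diff_valuation_Cons eventually_filtermap elim: eventually_mono)
  then have "diff_valuation n (proj n u # vs)"
    using dot.gram_schmidt_in_S[OF proj_ws] dot.orthonormal_gram_schmidt[OF proj_ws]
    by (simp add: diff_valuation_Cons vs_def proj_in_Rn)
  then show thesis
    using germ by (rule that)
qed

lemma diff_entails_antimono:
  assumes "n \<le> m" "diff_entails m \<Theta> \<psi>"
  shows "diff_entails n \<Theta> \<psi>"
  unfolding diff_entails_def
proof (intro allI impI)
  fix U
  assume U: "diff_valuation n U" and "\<forall>\<theta>\<in>\<Theta>. satisfies n U \<theta>"
  then show "satisfies n U \<psi>"
    using assms(2) diff_valuation_mono[OF assms(1) U]
    by (simp add: diff_entails_def satisfies_diff_valuation_iff)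
qed

lemma diff_entails_mono:
  assumes "n \<le> m" "\<Theta> \<subseteq> FORM n" "\<psi> \<in> FORM n" "diff_entails n \<Theta> \<psi>"
  shows "diff_entails m \<Theta> \<psi>"
  unfolding diff_entails_def
proof (intro allI impI)
  fix U
  assume U: "diff_valuation m U" and \<Theta>: "\<forall>\<theta>\<in>\<Theta>. satisfies m U \<theta>"
  obtain V where V: "diff_valuation n V" "simplex_germ V = filtermap (proj n) (simplex_germ U)"
    using ex_diff_valuation_proj[OF assms(1) U] .
  have "satisfies n V \<phi> \<longleftrightarrow> satisfies m U \<phi>" if "\<phi> \<in> FORM n" for \<phi>
    using that by (simp add: satisfies_diff_valuation_iff U V eventually_filtermap hat_proj)
  with \<Theta> assms(2-4) V(1) show "satisfies m U \<psi>"
    unfolding diff_entails_def by blast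
qed

theorem theorem3p11:
  fixes n :: nat and \<Theta> :: "form set" and \<psi> :: form
  assumes "n \<ge> 1" and "\<Theta> \<subseteq> FORM n" and "\<psi> \<in> FORM n"
  shows "\<forall>m\<ge>n. diff_entails n \<Theta> \<psi> \<longleftrightarrow> diff_entails m \<Theta> \<psi>"
  using diff_entails_mono[OF _ assms(2,3)] diff_entails_antimono by blast

end
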